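(* Let $n\ge1$, let $k\in\{0,\dots,n\}$ and let $\nu$ be a non-negative Radon measure on $\mathbb{R}$. The integral $$\int_{\mathbb{R}}V_k(\mathrm{cl}(\{u<t\}))\,d\nu(t)$$ is finite for every $u\in\mathcal{C}^n$ if and only if $$\int_{(0,\infty)}t^k\,d\nu(t)<\infty .$$
   Context: $\mathcal{C}^n$ is the set of all convex, lower semi-continuous functions $u:\mathbb{R}^n\to\mathbb{R}\cup\{\infty\}$ with $\lim_{|x|\to\infty}u(x)=\infty$ (including the function identically equal to $\infty$). $V_0,\dots,V_n$ are the intrinsic volumes of compact convex subsets of $\mathbb{R}^n$ (with $V_k(\emptyset)=0$). $\{u<t\}=\{x\in\mathbb{R}^n:u(x)<t\}$ is a bounded convex set and $\mathrm{cl}$ denotes closure. *)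

theory Defs
  imports "HOL-Analysis.Analysis"
begin

text \<open>
  The intrinsic volumes \<open>V\<^sub>0, \<dots>, V\<^sub>n\<close> of a compact convex set \<open>K\<close> in an \<open>n\<close>-dimensional
  Euclidean space are the normalised coefficients in Steiner's formula
  \<open>vol (K + \<epsilon> B) = (\<Sum>j\<le>n. \<kappa>\<^bsub>n-j\<^esub> V\<^sub>j(K) \<epsilon>^(n-j))\<close> for all \<open>\<epsilon> \<ge> 0\<close>, where \<open>B\<close> is the closed unit
  ball and \<open>\<kappa>\<^sub>i\<close> is the volume of the unit ball of dimension \<open>i\<close>. A polynomial function on
  \<open>[0, \<infinity>)\<close> determines its coefficients, so the description below is unique once the
  coefficients of index above \<open>n\<close> are set to zero. For \<open>K = {}\<close> the Minkowski sum is empty,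
  so all coefficients are \<open>0\<close>. The value is meaningless if \<open>K\<close> is not compact and convex.
\<close>

definition intrinsic_volume :: "nat \<Rightarrow> 'a::euclidean_space set \<Rightarrow> real" where
  "intrinsic_volume k K =
    (THE V :: nat \<Rightarrow> real.
        (\<forall>j>DIM('a). V j = 0) \<and>
        (\<forall>\<epsilon>\<ge>0. measure lborel (K + cball 0 \<epsilon>) =
           (\<Sum>j\<le>DIM('a). unit_ball_vol (real (DIM('a) - j)) * V j * \<epsilon> ^ (DIM('a) - j)))) k"

definition convex_fun :: "('a::real_vector \<Rightarrow> ereal) \<Rightarrow> bool" where
  "convex_fun u \<longleftrightarrow>
    (\<forall>x y. \<forall>t::real. 0 < t \<and> t < 1 \<longrightarrow>
       u ((1 - t) *\<^sub>R x + t *\<^sub>R y) \<le> ereal (1 - t) * u x + ereal t * u y)"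

definition lower_semicontinuous :: "('a::topological_space \<Rightarrow> ereal) \<Rightarrow> bool" where
  "lower_semicontinuous u \<longleftrightarrow> (\<forall>x. u x \<le> Liminf (at x) u)"

text \<open>Functions with values in \<open>\<real> \<union> {\<infinity>}\<close> are functions into \<^typ>\<open>ereal\<close> avoiding \<open>-\<infinity>\<close>.\<close>

definition coercive_convex_funs :: "('a::euclidean_space \<Rightarrow> ereal) set" where
  "coercive_convex_funs =
    {u. (\<forall>x. u x \<noteq> -\<infinity>) \<and> convex_fun u \<and> lower_semicontinuous u \<and> (u \<longlongrightarrow> \<infinity>) at_infinity}"

definition radon_measure :: "'a::topological_space measure \<Rightarrow> bool" where
  "radon_measure \<nu> \<longleftrightarrow>
    sets \<nu> = sets borel \<and>
    (\<forall>K. compact K \<longrightarrow> emeasure \<nu> K < \<infinity>) \<and>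
    (\<forall>A\<in>sets borel. emeasure \<nu> A = (SUP K\<in>{K. compact K \<and> K \<subseteq> A}. emeasure \<nu> K))"

end

theory Submission
  imports Defs
begin

text \<open>
  Steiner's formula makes the intrinsic volumes meaningful. For a polytope \<open>P\<close> it follows by cutting
  space into the finitely many pieces on which the nearest point in \<open>P\<close> is the orthogonal projection
  to a fixed affine space: dilating normally by \<open>r\<close> is affine on each piece, with determinant
  polynomial in \<open>r\<close>. A general \<open>K\<close> follows by approximation, because interpolation at \<open>0, \<dots>, n\<close> shows
  that pointwise limits of polynomials of degree at most \<open>n\<close> are again such polynomials.

  Interpolation also bounds the coefficients: if \<open>K\<close> lies in a ball of radius \<open>R\<close>, then
  \<open>V\<^sub>k(K) \<le> C R^k\<close>. Sublevel sets \<open>{u < t}\<close> are empty for small \<open>t\<close> and lie in balls whose radius grows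
  at most linearly in \<open>t\<close>, so finiteness of the moment implies finiteness for every \<open>u\<close>. Conversely,
  \<open>u = norm\<close> has balls of radius \<open>t\<close> as sublevel sets, for which \<open>V\<^sub>k\<close> is a positive multiple of \<open>t^k\<close>.
\<close>

section \<open>Polynomials of bounded degree\<close>

text \<open>The \<open>l i\<close> are the Lagrange polynomials for the nodes
  \<open>0, ..., n\<close>. Both sides of the expansion have degree at most \<open>n\<close> and
  agree at \<open>n + 1\<close> nodes, hence coincide.\<close>

lemma poly_interpolation_basis:
  fixes n :: nat
  obtains l :: "nat \<Rightarrow> real poly"
  where "\<And>i. i \<le> n \<Longrightarrow> degree (l i) \<le> n"
    and "\<And>p. degree p \<le> n \<Longrightarrow> p = (\<Sum>i\<le>n. smult (poly p (real i)) (l i))"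
proof -
  define l :: "nat \<Rightarrow> real poly" where
    "l i = (\<Prod>j\<in>{..n} - {i}. smult (1 / (real i - real j)) [:- real j, 1:])" for i
  have deg: "degree (l i) \<le> n" if "i \<le> n" for i
  proof -
    have "degree (l i) \<le> (\<Sum>j\<in>{..n} - {i}. 1)"
      unfolding l_def
      by (rule order_trans[OF degree_prod_sum_le]) (auto intro!: sum_mono order_trans[OF degree_smult_le])
    also have "\<dots> = n" using that by simp
    finally show ?thesis .
  qed
  have val: "poly (l i) (real m) = (if i = m then 1 else 0)" if "i \<le> n" "m \<le> n" for i m
  proof (cases "i = m")
    case True
    then show ?thesis
      by (auto simp: l_def poly_prod simp flip: diff_divide_distrib intro!: prod.neutral)
  next
    case False
    then have "m \<in> {..n} - {i}" using that by auto
    then show ?thesis using False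
      unfolding l_def poly_prod by (auto intro!: prod_zero bexI[of _ m])
  qed
  have "p = (\<Sum>i\<le>n. smult (poly p (real i)) (l i))" if p: "degree p \<le> n" for p
  proof (rule poly_eqI_degree[where A = "real ` {..n}"])
    fix x assume "x \<in> real ` {..n}"
    then obtain m where m: "m \<le> n" "x = real m" by auto
    have "poly (\<Sum>i\<le>n. smult (poly p (real i)) (l i)) x = (\<Sum>i\<le>n. if i = m then poly p (real i) else 0)"
      unfolding poly_sum m by (rule sum.cong) (use m val in auto)
    also have "\<dots> = poly p x" using m by simp
    finally show "poly p x = poly (\<Sum>i\<le>n. smult (poly p (real i)) (l i)) x" by simp
  next
    show "degree p < card (real ` {..n})" using p by (simp add: card_image)
    have "degree (\<Sum>i\<le>n. smult (poly p (real i)) (l i)) \<le> n"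
      by (rule degree_sum_le) (auto intro!: order_trans[OF degree_smult_le] deg)
    then show "degree (\<Sum>i\<le>n. smult (poly p (real i)) (l i)) < card (real ` {..n})"
      by (simp add: card_image)
  qed
  with deg show ?thesis using that by blast
qed

text \<open>Each \<open>p m\<close> equals its own interpolant, whose coefficients in the Lagrange
  basis are values at the nodes. These values converge, so the interpolant of \<open>f\<close> is
  the limit everywhere.\<close>

lemma pointwise_limit_of_polys:
  fixes p :: "nat \<Rightarrow> real poly" and f :: "real \<Rightarrow> real"
  assumes deg: "\<And>m. degree (p m) \<le> n"
    and lim: "\<And>x. x \<ge> 0 \<Longrightarrow> (\<lambda>m. poly (p m) x) \<longlonglongrightarrow> f x"
  obtains q where "degree q \<le> n" "\<And>x. x \<ge> 0 \<Longrightarrow> f x = poly q x"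
proof -
  obtain l :: "nat \<Rightarrow> real poly" where l: "\<And>i. i \<le> n \<Longrightarrow> degree (l i) \<le> n"
    "\<And>p. degree p \<le> n \<Longrightarrow> p = (\<Sum>i\<le>n. smult (poly p (real i)) (l i))"
    using poly_interpolation_basis[of n] by blast
  define q where "q = (\<Sum>i\<le>n. smult (f (real i)) (l i))"
  show thesis
  proof
    show "degree q \<le> n" unfolding q_def
      by (rule degree_sum_le) (auto intro!: order_trans[OF degree_smult_le] l)
    fix x :: real assume x: "x \<ge> 0"
    have "(\<lambda>m. \<Sum>i\<le>n. poly (p m) (real i) * poly (l i) x) \<longlonglongrightarrow> (\<Sum>i\<le>n. f (real i) * poly (l i) x)"
      by (intro tendsto_intros lim) simp
    moreover have "(\<Sum>i\<le>n. poly (p m) (real i) * poly (l i) x) = poly (p m) x" for m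
      using arg_cong[OF l(2)[OF deg[of m]], of "\<lambda>p. poly p x"] by (simp add: poly_sum)
    ultimately have "(\<lambda>m. poly (p m) x) \<longlonglongrightarrow> poly q x"
      by (simp add: q_def poly_sum)
    then show "f x = poly q x" using lim[OF x] LIMSEQ_unique by blast
  qed
qed

text \<open>Substituting \<open>R * x\<close> for \<open>x\<close> multiplies the
  \<open>j\<close>-th coefficient by \<open>R ^ j\<close> and moves the nodes into
  \<open>[0, n * R]\<close>. Expanding in the Lagrange basis then gives a constant that depends on
  \<open>n\<close> and \<open>j\<close> alone, which makes the bound scale correctly in
  \<open>R\<close>.\<close>

lemma poly_coeff_bound:
  fixes n j :: nat
  obtains C where "C \<ge> 0"
    "\<And>(p :: real poly) R M. degree p \<le> n \<Longrightarrow> R > 0 \<Longrightarrow>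
      (\<And>x. 0 \<le> x \<Longrightarrow> x \<le> real n * R \<Longrightarrow> \<bar>poly p x\<bar> \<le> M) \<Longrightarrow> \<bar>coeff p j\<bar> * R ^ j \<le> C * M"
proof -
  obtain l :: "nat \<Rightarrow> real poly" where l: "\<And>i. i \<le> n \<Longrightarrow> degree (l i) \<le> n"
    "\<And>p. degree p \<le> n \<Longrightarrow> p = (\<Sum>i\<le>n. smult (poly p (real i)) (l i))"
    using poly_interpolation_basis[of n] by blast
  define C where "C = (\<Sum>i\<le>n. \<bar>coeff (l i) j\<bar>)"
  show thesis
  proof
    show "C \<ge> 0" by (auto simp: C_def intro: sum_nonneg)
    fix p :: "real poly" and R M :: real
    assume p: "degree p \<le> n" and R: "R > 0"
      and M: "\<And>x. 0 \<le> x \<Longrightarrow> x \<le> real n * R \<Longrightarrow> \<bar>poly p x\<bar> \<le> M"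
    define q where "q = pcompose p [:0, R:]"
    have "degree q \<le> n" unfolding q_def using p by (simp add: degree_pcompose)
    then have "coeff q j = (\<Sum>i\<le>n. poly q (real i) * coeff (l i) j)"
      using arg_cong[OF l(2), of q "\<lambda>p. coeff p j"] by (simp add: coeff_sum)
    moreover have "\<bar>poly q (real i) * coeff (l i) j\<bar> \<le> M * \<bar>coeff (l i) j\<bar>" if "i \<le> n" for i
      unfolding abs_mult using that R
      by (intro mult_right_mono) (auto simp: q_def poly_pcompose mult.commute intro!: M)
    ultimately have "\<bar>coeff q j\<bar> \<le> C * M"
      by (auto simp: C_def sum_distrib_left mult.commute[of _ M] intro!: order_trans[OF sum_abs] sum_mono)
    moreover have "coeff q j = R ^ j * coeff p j"
      unfolding q_def by (rule coeff_pcompose_linear)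
    ultimately show "\<bar>coeff p j\<bar> * R ^ j \<le> C * M"
      using R by (simp add: abs_mult mult.commute)
  qed
qed

text \<open>In the Leibniz expansion every summand is a product of \<open>CARD('n)\<close> entries,
  each affine in \<open>x\<close>.\<close>

lemma det_affine_poly:
  fixes A B :: "real ^ 'n ^ 'n"
  obtains p :: "real poly" where "degree p \<le> CARD('n)" "\<And>x. det (x *\<^sub>R A + B) = poly p x"
proof
  define p :: "real poly" where
    "p = (\<Sum>\<sigma> | \<sigma> permutes (UNIV :: 'n set). smult (of_int (sign \<sigma>)) (\<Prod>i\<in>UNIV. [:B $ i $ \<sigma> i, A $ i $ \<sigma> i:]))"
  show "degree p \<le> CARD('n)" unfolding p_def
  proof (rule degree_sum_le)
    fix \<sigma> :: "'n \<Rightarrow> 'n"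
    have "degree (\<Prod>i\<in>UNIV. [:B $ i $ \<sigma> i, A $ i $ \<sigma> i:]) \<le> (\<Sum>i\<in>(UNIV :: 'n set). 1)"
      by (rule order_trans[OF degree_prod_sum_le], simp, intro sum_mono) simp
    then show "degree (smult (of_int (sign \<sigma>)) (\<Prod>i\<in>UNIV. [:B $ i $ \<sigma> i, A $ i $ \<sigma> i:])) \<le> CARD('n)"
      by (simp add: order_trans[OF degree_smult_le])
  qed (simp add: finite_permutations)
  show "det (x *\<^sub>R A + B) = poly p x" for x
    by (simp add: det_def p_def poly_sum poly_prod add.commute)
qed

section \<open>Nearest points in convex and affine sets\<close>

text \<open>The obtuse angle condition characterises the nearest point: adding the condition at
  \<open>y\<close> to the one at the true nearest point \<open>c\<close> gives
  \<open>norm (y - c) ^ 2 \<le> 0\<close>.\<close>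

lemma closest_point_eqI:
  fixes S :: "'a::euclidean_space set"
  assumes "convex S" "closed S" "y \<in> S" "\<And>z. z \<in> S \<Longrightarrow> (x - y) \<bullet> (z - y) \<le> 0"
  shows "closest_point S x = y"
proof -
  let ?c = "closest_point S x"
  have c: "?c \<in> S" using assms closest_point_in_set by blast
  have "(x - ?c) \<bullet> (y - ?c) \<le> 0" by (rule closest_point_dot) (use assms in auto)
  moreover have "(x - y) \<bullet> (?c - y) \<le> 0" using assms(4) c by blast
  moreover have "(x - ?c) \<bullet> (y - ?c) + (x - y) \<bullet> (?c - y) = (y - ?c) \<bullet> (y - ?c)"
    by (simp add: algebra_simps inner_commute)
  ultimately have "(y - ?c) \<bullet> (y - ?c) \<le> 0" by linarith
  then show ?thesis by (metis inner_gt_zero_iff not_less right_minus_eq)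
qed

text \<open>The obtuse angle condition survives scaling of \<open>x - closest_point S x\<close> by a
  nonnegative factor. Hence normal dilation does not change nearest points.\<close>

lemma closest_point_stretch:
  fixes S :: "'a::euclidean_space set"
  assumes "convex S" "closed S" "S \<noteq> {}" "r \<ge> 0"
  shows "closest_point S (closest_point S x + r *\<^sub>R (x - closest_point S x)) = closest_point S x"
proof (rule closest_point_eqI)
  show "closest_point S x \<in> S" using assms closest_point_in_set by blast
  fix z assume "z \<in> S"
  then have "(x - closest_point S x) \<bullet> (z - closest_point S x) \<le> 0"
    using assms closest_point_dot by blast
  then show "(closest_point S x + r *\<^sub>R (x - closest_point S x) - closest_point S x) \<bullet> (z - closest_point S x) \<le> 0"
    using assms(4) by (simp add: mult_nonneg_nonpos)
qed (use assms in auto)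

text \<open>An affine set allows a step from the nearest point along both \<open>z - w\<close> and
  \<open>w - z\<close>, so the obtuse angle inequality holds with both signs.\<close>

lemma closest_point_affine_orthogonal:
  fixes L :: "'a::euclidean_space set"
  assumes L: "affine L" and z: "z \<in> L" and w: "w \<in> L"
  shows "(x - closest_point L x) \<bullet> (z - w) = 0"
proof -
  let ?c = "closest_point L x"
  have cl: "closed L" and cv: "convex L" using L affine_closed affine_imp_convex by auto
  have c: "?c \<in> L" using cl z closest_point_in_set by blast
  have "?c + z - w \<in> L" "?c + w - z \<in> L"
    using mem_affine_3_minus[OF L c, of _ _ 1] z w by (auto simp: algebra_simps)
  then have "(x - ?c) \<bullet> (?c + z - w - ?c) \<le> 0" "(x - ?c) \<bullet> (?c + w - z - ?c) \<le> 0"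
    using closest_point_dot[OF cv cl] by blast+
  then show ?thesis by (simp add: inner_diff_right)
qed

lemma closest_point_affine_eqI:
  fixes L :: "'a::euclidean_space set"
  assumes "affine L" "y \<in> L" "\<And>z. z \<in> L \<Longrightarrow> (x - y) \<bullet> (z - y) = 0"
  shows "closest_point L x = y"
  by (rule closest_point_eqI) (use assms affine_closed affine_imp_convex in auto)

lemma closest_point_affine_linear:
  fixes L :: "'a::euclidean_space set"
  assumes L: "affine L" and ne: "L \<noteq> {}"
  shows "linear (\<lambda>x. closest_point L x - closest_point L 0)"
proof -
  let ?c = "closest_point L"
  have c: "?c x \<in> L" for x using L affine_closed ne closest_point_in_set by blast
  have orth: "(x - ?c x) \<bullet> (z - w) = 0" if "z \<in> L" "w \<in> L" for x z w
    using closest_point_affine_orthogonal L that by blast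
  have add: "?c (x + y) = ?c x + ?c y - ?c 0" for x y
  proof (rule closest_point_affine_eqI[OF L])
    show m: "?c x + ?c y - ?c 0 \<in> L"
      using mem_affine_3_minus[OF L c c c, of x 1 y 0] by (simp add: algebra_simps)
    fix z assume z: "z \<in> L"
    \<comment> \<open>The residual of the candidate is a combination of three residuals, each
      orthogonal to the directions of \<open>L\<close>.\<close>
    have "x + y - (?c x + ?c y - ?c 0) = (x - ?c x) + (y - ?c y) - (0 - ?c 0)" by simp
    then show "(x + y - (?c x + ?c y - ?c 0)) \<bullet> (z - (?c x + ?c y - ?c 0)) = 0"
      using orth[OF z m] by (simp only: inner_add_left inner_diff_left[of _ "0 - ?c 0"])
  qed
  have scale: "?c (r *\<^sub>R x) = r *\<^sub>R ?c x + (1 - r) *\<^sub>R ?c 0" for r x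
  proof (rule closest_point_affine_eqI[OF L])
    show m: "r *\<^sub>R ?c x + (1 - r) *\<^sub>R ?c 0 \<in> L"
      using L c unfolding affine_def by simp
    fix z assume z: "z \<in> L"
    have "r *\<^sub>R x - (r *\<^sub>R ?c x + (1 - r) *\<^sub>R ?c 0) = r *\<^sub>R (x - ?c x) + (1 - r) *\<^sub>R (0 - ?c 0)"
      by (simp add: algebra_simps)
    then show "(r *\<^sub>R x - (r *\<^sub>R ?c x + (1 - r) *\<^sub>R ?c 0)) \<bullet> (z - (r *\<^sub>R ?c x + (1 - r) *\<^sub>R ?c 0)) = 0"
      using orth[OF z m] by (simp only: inner_add_left inner_scaleR_left)
  qed
  show ?thesis
    by (rule linearI) (simp_all add: add scale algebra_simps)
qed

text \<open>Both projections are affine maps, so the set where they agree is affine. If it were the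
  whole space, the projections would have the same range and \<open>L = M\<close>; a proper affine
  subspace is a null set. This makes overlaps of the pieces in the polytope case negligible.\<close>

lemma negligible_eq_closest_point_affine:
  fixes L M :: "'a::euclidean_space set"
  assumes L: "affine L" "L \<noteq> {}" and M: "affine M" "M \<noteq> {}" and "L \<noteq> M"
  shows "negligible {x. closest_point L x = closest_point M x}"
proof -
  let ?E = "{x. closest_point L x = closest_point M x}"
  let ?g = "\<lambda>x. (closest_point L x - closest_point L 0) - (closest_point M x - closest_point M 0)"
  have lin: "linear ?g"
    by (intro linear_compose_sub closest_point_affine_linear assms)
  have E: "?E = {x. ?g x = closest_point M 0 - closest_point L 0}"
    by (auto simp: algebra_simps)
  have aff: "affine ?E"
    unfolding E affine_def
  proof safe
    fix x y :: 'a and u v :: real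
    assume "?g x = closest_point M 0 - closest_point L 0" "?g y = closest_point M 0 - closest_point L 0"
      and "u + v = 1"
    moreover have "?g (u *\<^sub>R x + v *\<^sub>R y) = u *\<^sub>R ?g x + v *\<^sub>R ?g y"
      by (simp only: linear_add[OF lin] linear_scale[OF lin])
    ultimately show "?g (u *\<^sub>R x + v *\<^sub>R y) = closest_point M 0 - closest_point L 0"
      by (simp only: scaleR_left_distrib[symmetric] scaleR_one)
  qed
  have inL: "closest_point L x \<in> L" for x using L affine_closed closest_point_in_set by blast
  have inM: "closest_point M x \<in> M" for x using M affine_closed closest_point_in_set by blast
  have "?E \<noteq> UNIV"
  proof
    assume "?E = UNIV"
    then have eq: "closest_point L x = closest_point M x" for x by blast
    have "x \<in> M" if "x \<in> L" for x using inM[of x] eq[of x] closest_point_self[OF that] by simp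
    moreover have "x \<in> L" if "x \<in> M" for x using inL[of x] eq[of x] closest_point_self[OF that] by simp
    ultimately show False using \<open>L \<noteq> M\<close> by blast
  qed
  then have "interior ?E = {}"
    using affine_hull_nonempty_interior[of ?E] aff by (metis affine_hull_eq)
  then show ?thesis
    using negligible_convex_interior affine_imp_convex[OF aff] by blast
qed

section \<open>Steiner's formula for polytopes\<close>

lemma mem_set_plus_cball:
  fixes K :: "'a::euclidean_space set"
  assumes "closed K" "K \<noteq> {}"
  shows "x \<in> K + cball 0 r \<longleftrightarrow> dist x (closest_point K x) \<le> r"
proof
  assume "x \<in> K + cball 0 r"
  then obtain k b where "k \<in> K" "b \<in> cball 0 r" "x = k + b" by (auto simp: set_plus_def)
  moreover have "dist x (closest_point K x) \<le> dist x k"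
    using closest_point_exists(2)[OF assms] \<open>k \<in> K\<close> by blast
  ultimately show "dist x (closest_point K x) \<le> r" by (simp add: dist_norm)
next
  assume "dist x (closest_point K x) \<le> r"
  moreover have "x = closest_point K x + (x - closest_point K x)" by simp
  ultimately show "x \<in> K + cball 0 r"
    using closest_point_in_set[OF assms] unfolding set_plus_def
    by (force simp: dist_norm)
qed

lemma compact_set_plus_cball:
  fixes K :: "'a::euclidean_space set"
  assumes "compact K"
  shows "compact (K + cball 0 r)"
proof -
  have "K + cball 0 r = {x + y | x y. x \<in> K \<and> y \<in> cball 0 r}"
    unfolding set_plus_def by blast
  then show ?thesis using compact_sums[OF assms compact_cball, of 0 r] by simp
qed

text \<open>The dilation away from \<open>L\<close> is affine with linear part
  \<open>r (I - Q) + Q\<close>, where \<open>Q\<close> is the linear part of the projection. Volume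
  scales by the absolute determinant, so it remains to show that the determinant polynomial is
  positive for \<open>r > 0\<close>.\<close>

lemma measure_scaling_affine_map:
  fixes L :: "(real ^ 'n::{finite,wellorder}) set"
  assumes L: "affine L" "L \<noteq> {}"
  obtains d :: "real poly" where "degree d \<le> CARD('n)"
    "\<And>r S. r > 0 \<Longrightarrow> S \<in> lmeasurable \<Longrightarrow>
      measure lebesgue ((\<lambda>x. closest_point L x + r *\<^sub>R (x - closest_point L x)) ` S)
        = poly d r * measure lebesgue S"
proof -
  define c where "c = closest_point L 0"
  define q where "q = (\<lambda>x. closest_point L x - c)"
  define T where "T r x = r *\<^sub>R (x - q x) + q x" for r x
  have q: "linear q" unfolding q_def c_def by (rule closest_point_affine_linear[OF L])
  have T: "linear (T r)" for r
    unfolding T_def by (intro linear_compose_add linear_compose_scale_right linear_compose_sub q linear_id[unfolded id_def])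
  have phi: "closest_point L x + r *\<^sub>R (x - closest_point L x) = (1 - r) *\<^sub>R c + T r x" for r x
    by (simp add: T_def q_def algebra_simps)
  have mat: "matrix (T r) = r *\<^sub>R (mat 1 - matrix q) + matrix q" for r
    by (simp add: matrix_def T_def vec_eq_iff mat_def axis_def)
  obtain d :: "real poly" where d: "degree d \<le> CARD('n)"
    and det: "\<And>r. det (r *\<^sub>R (mat 1 - matrix q) + matrix q) = poly d r"
    using det_affine_poly[of "mat 1 - matrix q" "matrix q"] by blast
  have det': "det (matrix (T r)) = poly d r" for r using det mat by simp
  have d1: "poly d 1 = 1" by (simp flip: det)
  \<comment> \<open>For \<open>r > 0\<close> the map is injective: the image point has the same
    nearest point in \<open>L\<close> as \<open>x\<close>, and this recovers
    \<open>x\<close>.\<close>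
  have dn0: "poly d r \<noteq> 0" if "r > 0" for r
  proof -
    have cl: "convex L" "closed L" using L affine_closed affine_imp_convex by auto
    have "inj (\<lambda>x. closest_point L x + r *\<^sub>R (x - closest_point L x))"
    proof (rule injI)
      fix x y
      assume eq: "closest_point L x + r *\<^sub>R (x - closest_point L x) = closest_point L y + r *\<^sub>R (y - closest_point L y)"
      then have "closest_point L x = closest_point L y"
        using closest_point_stretch[OF cl L(2), of r x] closest_point_stretch[OF cl L(2), of r y] that by simp
      then show "x = y" using eq that by simp
    qed
    then have "inj (T r)" unfolding phi by (simp add: inj_def)
    then show ?thesis using det_nz_iff_inj[OF T] det' by metis
  qed
  \<comment> \<open>A negative value together with \<open>poly d 1 = 1\<close> would force a
    positive zero by the intermediate value theorem.\<close>
  have dpos: "poly d r > 0" if "r > 0" for r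
  proof (rule ccontr)
    assume "\<not> ?thesis"
    then have neg: "poly d r < 0" using dn0[OF that] by linarith
    have "r \<noteq> 1" using neg d1 by auto
    then consider "r < 1" | "1 < r" by linarith
    then obtain s where "s > 0" "poly d s = 0"
    proof cases
      case 1
      then obtain s where "r < s" "poly d s = 0" using poly_IVT_pos[OF 1 neg] d1 by auto
      then show ?thesis using that \<open>r > 0\<close> by (meson less_trans)
    next
      case 2
      then obtain s where "1 < s" "poly d s = 0" using poly_IVT_neg[OF 2 _ neg] d1 by auto
      then show ?thesis using that by (meson less_trans zero_less_one)
    qed
    then show False using dn0 by blast
  qed
  show thesis
  proof
    show "degree d \<le> CARD('n)" by (rule d)
    fix r :: real and S :: "(real ^ 'n::{finite,wellorder}) set"
    assume r: "r > 0" and S: "S \<in> lmeasurable"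
    have "(\<lambda>x. closest_point L x + r *\<^sub>R (x - closest_point L x)) ` S = (+) ((1 - r) *\<^sub>R c) ` (T r ` S)"
      unfolding phi by (simp add: image_image)
    then show "measure lebesgue ((\<lambda>x. closest_point L x + r *\<^sub>R (x - closest_point L x)) ` S)
        = poly d r * measure lebesgue S"
      using measure_linear_image[OF T S, of r] dpos[OF r] by (simp add: measure_translation det')
  qed
qed

text \<open>Write the nearest point \<open>p\<close> as a convex combination and let
  \<open>S\<close> be the vertices of nonzero weight. The numbers
  \<open>(x - p) \<bullet> (v - p)\<close> are nonpositive and their weighted sum is zero, so they
  vanish on \<open>S\<close>. Thus \<open>x - p\<close> is orthogonal to the affine hull of
  \<open>S\<close>, which contains \<open>p\<close>.\<close>

lemma closest_point_convex_hull_affine: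
  fixes V :: "'a::euclidean_space set"
  assumes V: "finite V" "V \<noteq> {}"
  obtains S where "S \<subseteq> V" "S \<noteq> {}" "closest_point (convex hull V) x = closest_point (affine hull S) x"
proof -
  let ?P = "convex hull V"
  define p where "p = closest_point ?P x"
  have cl: "closed ?P" "?P \<noteq> {}" using V by (auto simp: finite_imp_compact_convex_hull compact_imp_closed)
  have "p \<in> ?P" unfolding p_def by (rule closest_point_in_set[OF cl])
  then obtain u where u: "\<And>v. v \<in> V \<Longrightarrow> 0 \<le> u v" "sum u V = 1" "(\<Sum>v\<in>V. u v *\<^sub>R v) = p"
    unfolding convex_hull_finite[OF V(1)] by blast
  define S where "S = {v\<in>V. u v \<noteq> 0}"
  have "sum u S = sum u V" unfolding S_def
    by (rule sum.mono_neutral_left) (use V in auto)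
  moreover have "(\<Sum>v\<in>S. u v *\<^sub>R v) = (\<Sum>v\<in>V. u v *\<^sub>R v)" unfolding S_def
    by (rule sum.mono_neutral_left) (use V in auto)
  ultimately have sS: "sum u S = 1" "(\<Sum>v\<in>S. u v *\<^sub>R v) = p" using u by simp_all
  have le: "(x - p) \<bullet> (v - p) \<le> 0" if "v \<in> V" for v
    unfolding p_def using closest_point_dot[OF convex_convex_hull cl(1)] hull_inc[OF that] by blast
  have "(\<Sum>v\<in>V. u v * ((x - p) \<bullet> (v - p))) = (x - p) \<bullet> (\<Sum>v\<in>V. u v *\<^sub>R (v - p))"
    by (simp add: inner_sum_right)
  also have "(\<Sum>v\<in>V. u v *\<^sub>R (v - p)) = 0"
    using u by (simp add: scaleR_diff_right sum_subtractf flip: scaleR_left.sum)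
  finally have "(\<Sum>v\<in>V. - (u v * ((x - p) \<bullet> (v - p)))) = 0" by (simp add: sum_negf)
  then have "\<forall>v\<in>V. - (u v * ((x - p) \<bullet> (v - p))) = 0"
    by (subst (asm) sum_nonneg_eq_0_iff) (use V u le in \<open>auto intro: mult_nonneg_nonpos\<close>)
  then have zero: "(x - p) \<bullet> (v - p) = 0" if "v \<in> S" for v using that by (auto simp: S_def)
  have "finite S" using V by (simp add: S_def)
  then have pS: "p \<in> affine hull S" using sS by (auto simp: affine_hull_finite)
  have "affine hull S \<subseteq> {z. (x - p) \<bullet> z = (x - p) \<bullet> p}"
    by (rule hull_minimal) (use zero in \<open>auto simp: inner_diff_right affine_hyperplane\<close>)
  then have "closest_point (affine hull S) x = p"
    by (intro closest_point_affine_eqI pS) (auto simp: inner_diff_right)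
  moreover have "S \<noteq> {}" using sS by auto
  ultimately show thesis using that[of S] by (auto simp: S_def p_def)
qed

lemma steiner_polytope:
  fixes V :: "(real ^ 'n::{finite,wellorder}) set"
  assumes V: "finite V" "V \<noteq> {}"
  obtains p :: "real poly" where "degree p \<le> CARD('n)"
    "\<And>r. r > 0 \<Longrightarrow> measure lebesgue (convex hull V + cball 0 r) = poly p r"
proof -
  define P where "P = convex hull V"
  have P: "convex P" "closed P" "P \<noteq> {}" "compact P"
    using V by (auto simp: P_def finite_imp_compact_convex_hull compact_imp_closed)
  \<comment> \<open>The members are the affine hulls themselves, not the vertex sets: different
    vertex sets may span the same subspace, and only distinct subspaces give pieces with negligible
    overlap.\<close>
  define F where "F = (\<lambda>S. affine hull S) ` {S. S \<subseteq> V \<and> S \<noteq> {}}"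
  have F: "finite F" "\<And>L. L \<in> F \<Longrightarrow> affine L" "\<And>L. L \<in> F \<Longrightarrow> L \<noteq> {}"
    using V by (auto simp: F_def affine_hull_eq_empty)
  have FL: "convex L" "closed L" if "L \<in> F" for L
    using F(2)[OF that] affine_closed affine_imp_convex by auto
  define A where "A L = {x. closest_point P x = closest_point L x}" for L
  have closedA: "closed (A L)" if "L \<in> F" for L
    unfolding A_def
    using continuous_on_closest_point[OF P(1-3), of UNIV]
      continuous_on_closest_point[OF FL[OF that] F(3)[OF that], of UNIV]
    by (rule closed_Collect_eq)
  define N where "N r = P + cball 0 r" for r
  have N: "x \<in> N r \<longleftrightarrow> dist x (closest_point P x) \<le> r" for x r
    unfolding N_def by (rule mem_set_plus_cball[OF P(2,3)])
  have meas: "A L \<inter> N r \<in> lmeasurable" if "L \<in> F" for L r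
    using closedA[OF that] compact_set_plus_cball[OF P(4), of r]
    by (intro lmeasurable_compact closed_Int_compact) (auto simp: N_def)
  have cover: "N r = (\<Union>L\<in>F. A L \<inter> N r)" for r
  proof -
    have "\<exists>L\<in>F. x \<in> A L" for x
    proof -
      obtain S where "S \<subseteq> V" "S \<noteq> {}" "closest_point (convex hull V) x = closest_point (affine hull S) x"
        using closest_point_convex_hull_affine[OF V] .
      then show ?thesis
        by (intro bexI[of _ "affine hull S"]) (auto simp: A_def F_def P_def)
    qed
    then show ?thesis by auto
  qed
  have disj: "pairwise (\<lambda>L M. negligible ((A L \<inter> N r) \<inter> (A M \<inter> N r))) F" for r
  proof (rule pairwiseI)
    fix L M assume "L \<in> F" "M \<in> F" "L \<noteq> M"
    then have "negligible {x. closest_point L x = closest_point M x}"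
      using F(2,3) negligible_eq_closest_point_affine by metis
    then show "negligible ((A L \<inter> N r) \<inter> (A M \<inter> N r))"
      by (rule negligible_subset) (auto simp: A_def)
  qed
  \<comment> \<open>Within \<open>A L\<close> the dilation fixes nearest points and multiplies the
    distance to \<open>P\<close> by \<open>r\<close>; the dilation by \<open>inverse r\<close>
    undoes it.\<close>
  have scale: "(\<lambda>x. closest_point L x + r *\<^sub>R (x - closest_point L x)) ` (A L \<inter> N 1) = A L \<inter> N r"
    if L: "L \<in> F" and r: "r > 0" for L r
  proof -
    define f where "f r x = closest_point L x + r *\<^sub>R (x - closest_point L x)" for r x
    have fA: "f s x \<in> A L \<and> closest_point L (f s x) = closest_point L x" if "x \<in> A L" "s > 0" for s x
      using closest_point_stretch[OF FL[OF L] F(3)[OF L], of s x]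
        closest_point_stretch[OF P(1-3), of s x] that by (simp add: f_def A_def)
    have fN: "f s x \<in> N (s * t)" if "x \<in> A L" "x \<in> N t" "s > 0" for s t x
    proof -
      have "closest_point P (f s x) = closest_point L x" using fA[OF that(1,3)] by (simp add: A_def)
      moreover have "dist (f s x) (closest_point L x) = s * dist x (closest_point L x)"
        using that(3) by (simp add: f_def dist_norm)
      ultimately show ?thesis using that by (simp add: N A_def)
    qed
    have inv: "f s (f (inverse s) x) = x" if "x \<in> A L" "s > 0" for s x
    proof -
      have "closest_point L (f (inverse s) x) = closest_point L x" using fA that by simp
      then have "f s (f (inverse s) x) = closest_point L x + s *\<^sub>R (f (inverse s) x - closest_point L x)"
        by (simp add: f_def[of s])
      then show ?thesis using that(2) by (simp add: f_def)
    qed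
    have "f r ` (A L \<inter> N 1) = A L \<inter> N r"
    proof safe
      fix x assume x: "x \<in> A L" "x \<in> N 1"
      show "f r x \<in> A L" using fA x r by blast
      show "f r x \<in> N r" using fN[OF x r] by simp
    next
      fix x assume x: "x \<in> A L" "x \<in> N r"
      have "f (inverse r) x \<in> A L \<inter> N 1"
        using fA[OF x(1), of "inverse r"] fN[OF x, of "inverse r"] r by simp
      then show "x \<in> f r ` (A L \<inter> N 1)" 
        using inv[OF x(1) r] by (intro image_eqI[of _ _ "f (inverse r) x"]) simp_all
    qed
    then show ?thesis unfolding f_def[abs_def] .
  qed
  have "\<exists>d. degree d \<le> CARD('n) \<and> (\<forall>r S. r > 0 \<longrightarrow> S \<in> lmeasurable \<longrightarrow>
      measure lebesgue ((\<lambda>x. closest_point L x + r *\<^sub>R (x - closest_point L x)) ` S)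
        = poly d r * measure lebesgue S)" if L: "L \<in> F" for L
    by (rule measure_scaling_affine_map[OF F(2)[OF L] F(3)[OF L]], rule exI) auto
  then have "\<forall>L\<in>F. \<exists>d. degree d \<le> CARD('n) \<and> (\<forall>r S. r > 0 \<longrightarrow> S \<in> lmeasurable \<longrightarrow>
      measure lebesgue ((\<lambda>x. closest_point L x + r *\<^sub>R (x - closest_point L x)) ` S)
        = poly d r * measure lebesgue S)" by (rule ballI)
  from bchoice[OF this] obtain d where d: "\<And>L. L \<in> F \<Longrightarrow> degree (d L) \<le> CARD('n)"
    "\<And>L r S. L \<in> F \<Longrightarrow> r > 0 \<Longrightarrow> S \<in> lmeasurable \<Longrightarrow>
      measure lebesgue ((\<lambda>x. closest_point L x + r *\<^sub>R (x - closest_point L x)) ` S)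
        = poly (d L) r * measure lebesgue S"
    by blast
  \<comment> \<open>Each piece of the parallel body at distance \<open>r\<close> is the dilated
    piece at distance \<open>1\<close>, so its volume is the reference volume times
    \<open>poly (d L) r\<close>.\<close>
  define p where "p = (\<Sum>L\<in>F. smult (measure lebesgue (A L \<inter> N 1)) (d L))"
  show thesis
  proof
    show "degree p \<le> CARD('n)" unfolding p_def
      by (rule degree_sum_le) (auto intro!: F order_trans[OF degree_smult_le] d)
    fix r :: real assume r: "r > 0"
    have "measure lebesgue (N r) = (\<Sum>L\<in>F. measure lebesgue (A L \<inter> N r))"
      using measure_negligible_finite_Union_image[OF F(1) meas disj, of r] cover[of r] by simp
    also have "\<dots> = (\<Sum>L\<in>F. poly (d L) r * measure lebesgue (A L \<inter> N 1))"
      by (rule sum.cong[OF refl], subst scale[symmetric]) (use r d(2) meas in auto)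
    also have "\<dots> = poly p r" by (simp add: p_def poly_sum mult.commute)
    finally show "measure lebesgue (convex hull V + cball 0 r) = poly p r"
      by (simp add: N_def P_def)
  qed
qed

section \<open>Steiner's formula for compact convex sets\<close>

lemma Inter_set_plus_cball:
  fixes K :: "'a::euclidean_space set"
  assumes "compact K"
  shows "(\<Inter>m. K + cball 0 (e + inverse (real (Suc m)))) = K + cball 0 e"
proof (cases "K = {}")
  case True
  then show ?thesis by (simp add: set_plus_def)
next
  case False
  have iff: "x \<in> K + cball 0 r \<longleftrightarrow> dist x (closest_point K x) \<le> r" for x r
    by (rule mem_set_plus_cball[OF compact_imp_closed[OF assms] False])
  have "a \<le> e" if "\<And>m. a \<le> e + inverse (real (Suc m))" for a
    using LIMSEQ_le_const[OF LIMSEQ_inverse_real_of_nat_add, of a e] that by blast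
  moreover have "e \<le> e + inverse (real (Suc m))" for m by simp
  ultimately show ?thesis
    unfolding set_eq_iff INT_iff iff by (meson UNIV_I order_trans)
qed

text \<open>This is continuity from above along the decreasing parallel bodies, whose intersection
  is the parallel body of radius \<open>e\<close>.\<close>

lemma measure_cball_sum_right_continuous:
  fixes K :: "'a::euclidean_space set"
  assumes "compact K"
  shows "(\<lambda>m. measure lebesgue (K + cball 0 (e + inverse (real (Suc m))))) \<longlonglongrightarrow> measure lebesgue (K + cball 0 e)"
proof -
  define A where "A m = K + cball 0 (e + inverse (real (Suc m)))" for m
  have "A m \<in> lmeasurable" for m
    unfolding A_def by (intro lmeasurable_compact compact_set_plus_cball assms)
  then have "range A \<subseteq> sets lebesgue" "emeasure lebesgue (A m) \<noteq> \<infinity>" for m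
    by (auto dest: fmeasurableD fmeasurableD2 simp del: emeasure_completion)
  moreover have "decseq A"
    unfolding decseq_def
  proof (intro allI impI)
    fix m n :: nat assume "m \<le> n"
    then have "inverse (real (Suc n)) \<le> inverse (real (Suc m))" by (simp add: le_imp_inverse_le)
    then show "A n \<subseteq> A m" unfolding A_def
      by (intro set_plus_mono2 order_refl subset_cball add_left_mono)
  qed
  ultimately have "(\<lambda>m. measure lebesgue (A m)) \<longlonglongrightarrow> measure lebesgue (\<Inter>m. A m)"
    by (intro Lim_measure_decseq)
  then show ?thesis
    using Inter_set_plus_cball[OF assms] by (simp add: A_def)
qed

lemma compact_finite_net:
  fixes K :: "'a::euclidean_space set"
  assumes "compact K" "d > 0"
  obtains V where "finite V" "V \<subseteq> K" "K \<subseteq> V + cball 0 d"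
proof -
  obtain V where V: "finite V" "V \<subseteq> K" "K \<subseteq> (\<Union>x\<in>V. ball x d)"
    using seq_compact_imp_totally_bounded[OF compact_imp_seq_compact[OF assms(1)], rule_format, OF assms(2)]
    by (elim exE conjE)
  have "x \<in> V + cball 0 d" if x: "x \<in> K" for x
  proof -
    obtain v where "v \<in> V" "dist v x < d" using subsetD[OF V(3) x] by auto
    then have "v + (x - v) \<in> V + cball 0 d"
      by (intro set_plus_intro) (auto simp: dist_norm norm_minus_commute)
    then show ?thesis by simp
  qed
  then show thesis using that V by blast
qed

text \<open>The hull \<open>Q\<close> of a finite \<delta>-net of \<open>K\<close> satisfies
  \<open>K + r B \<subseteq> Q + (r + \<delta>) B \<subseteq> K + (r + \<delta>) B\<close>. By right
  continuity the polynomials of these hulls, shifted by \<delta>, converge to the volume function of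
  \<open>K\<close>.\<close>

lemma steiner_compact_convex:
  fixes K :: "(real ^ 'n::{finite,wellorder}) set"
  assumes K: "compact K" "convex K"
  obtains p :: "real poly" where "degree p \<le> CARD('n)"
    "\<And>r. r \<ge> 0 \<Longrightarrow> measure lebesgue (K + cball 0 r) = poly p r"
proof (cases "K = {}")
  case True
  then show thesis using that[of 0] by (simp add: set_plus_def)
next
  case False
  define \<delta> where "\<delta> m = inverse (real (Suc m))" for m
  have \<delta>: "\<delta> m > 0" for m by (simp add: \<delta>_def)
  have ex: "\<exists>p. degree p \<le> CARD('n) \<and> (\<forall>r\<ge>0. measure lebesgue (K + cball 0 r) \<le> poly p r
      \<and> poly p r \<le> measure lebesgue (K + cball 0 (r + \<delta> m)))" for m
  proof -
    obtain V where V: "finite V" "V \<subseteq> K" "K \<subseteq> V + cball 0 (\<delta> m)"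
      using compact_finite_net[OF K(1) \<delta>] .
    have "V \<noteq> {}" using V(3) False by (auto simp: set_plus_def)
    then obtain q :: "real poly" where q: "degree q \<le> CARD('n)"
      "\<And>r. r > 0 \<Longrightarrow> measure lebesgue (convex hull V + cball 0 r) = poly q r"
      using steiner_polytope[OF V(1)] by blast
    have hull: "V \<subseteq> convex hull V" "convex hull V \<subseteq> K"
      using V(2) K(2) by (simp_all add: hull_subset hull_minimal)
    have meas: "L + cball 0 r \<in> lmeasurable" if "compact L" for r and L :: "(real ^ 'n::{finite,wellorder}) set"
      using lmeasurable_compact[OF compact_set_plus_cball[OF that]] .
    have cV: "compact (convex hull V)" using V finite_imp_compact_convex_hull by blast
    have bounds: "measure lebesgue (K + cball 0 r) \<le> poly q (r + \<delta> m)
        \<and> poly q (r + \<delta> m) \<le> measure lebesgue (K + cball 0 (r + \<delta> m))" if r: "r \<ge> 0" for r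
    proof
      have rd: "r + \<delta> m > 0" using r \<delta>[of m] by linarith
      have "K + cball 0 r \<subseteq> convex hull V + cball 0 (\<delta> m) + cball 0 r"
        
        using order_trans[OF V(3) set_plus_mono2[OF hull(1) order_refl]] by (rule set_plus_mono2) simp
      also have "\<dots> \<subseteq> convex hull V + cball 0 (r + \<delta> m)"
        unfolding add.assoc
        by (intro set_plus_mono2) (auto simp: set_plus_def intro!: norm_triangle_le)
      finally show "measure lebesgue (K + cball 0 r) \<le> poly q (r + \<delta> m)"
        unfolding q(2)[OF rd, symmetric]
        by (intro measure_mono_fmeasurable meas cV fmeasurableD K)
      show "poly q (r + \<delta> m) \<le> measure lebesgue (K + cball 0 (r + \<delta> m))"
        unfolding q(2)[OF rd, symmetric]
        by (intro measure_mono_fmeasurable meas cV fmeasurableD K set_plus_mono2 hull order_refl)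
    qed
    show ?thesis
      \<comment> \<open>The polynomial in \<open>r\<close> is \<open>q\<close> evaluated at
        \<open>r + \<delta> m\<close>. The shift keeps the argument positive, where \<open>q\<close>
        is known to give the volume, even for \<open>r = 0\<close>.\<close>
      by (intro exI[of _ "pcompose q [:\<delta> m, 1:]"])
        (use bounds q(1) in \<open>simp add: degree_pcompose poly_pcompose add.commute\<close>)
  qed
  have "\<exists>p. \<forall>m. degree (p m) \<le> CARD('n) \<and> (\<forall>r\<ge>0. measure lebesgue (K + cball 0 r) \<le> poly (p m) r
      \<and> poly (p m) r \<le> measure lebesgue (K + cball 0 (r + \<delta> m)))"
    by (rule choice) (rule allI, rule ex)
  then obtain p where p': "\<forall>m. degree (p m) \<le> CARD('n) \<and> (\<forall>r\<ge>0. measure lebesgue (K + cball 0 r) \<le> poly (p m) r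
      \<and> poly (p m) r \<le> measure lebesgue (K + cball 0 (r + \<delta> m)))" by (rule exE)
  have p: "degree (p m) \<le> CARD('n)"
    "r \<ge> 0 \<Longrightarrow> measure lebesgue (K + cball 0 r) \<le> poly (p m) r"
    "r \<ge> 0 \<Longrightarrow> poly (p m) r \<le> measure lebesgue (K + cball 0 (r + \<delta> m))" for m r
    using p'[rule_format, of m] by simp_all
  have lim: "(\<lambda>m. poly (p m) r) \<longlonglongrightarrow> measure lebesgue (K + cball 0 r)" if "r \<ge> 0" for r
    by (rule tendsto_sandwich[OF _ _ tendsto_const measure_cball_sum_right_continuous[OF K(1)]])
      (use p that in \<open>auto simp: \<delta>_def\<close>)
  show thesis
    by (rule pointwise_limit_of_polys[OF p(1)], rule lim, assumption) (rule that)
qed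

text \<open>The change of variables formula of the library needs an index type of class \<open>wellorder\<close>.
  Every finite type is in bijection with such a type, and renaming coordinates preserves both
  distances and Lebesgue measure.\<close>

typedef 'a enumerated = "UNIV :: 'a set" ..

lemma inj_Rep_enumerated: "inj Rep_enumerated"
  by (rule injI) (simp only: Rep_enumerated_inject)

lemma bij_Rep_enumerated: "bij Rep_enumerated"
  unfolding bij_def using inj_Rep_enumerated surjI[of Rep_enumerated, OF Abs_enumerated_inverse] by simp

instance enumerated :: (finite) finite
  by standard (rule finite_imageD[OF _ inj_Rep_enumerated], simp)

instantiation enumerated :: (countable) wellorder
begin

definition "x \<le> y \<longleftrightarrow> to_nat (Rep_enumerated x) \<le> to_nat (Rep_enumerated y)"
definition "x < y \<longleftrightarrow> to_nat (Rep_enumerated x) < to_nat (Rep_enumerated y)"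

instance
proof
  fix x y z :: "'a enumerated"
  show "x < y \<longleftrightarrow> x \<le> y \<and> \<not> y \<le> x" "x \<le> x" "x \<le> y \<or> y \<le> x"
    by (auto simp: less_eq_enumerated_def less_enumerated_def)
  show "x \<le> z" if "x \<le> y" "y \<le> z"
    using that by (simp add: less_eq_enumerated_def)
  show "x = y" if "x \<le> y" "y \<le> x"
    using that by (simp add: less_eq_enumerated_def flip: Rep_enumerated_inject)
next
  fix P :: "'a enumerated \<Rightarrow> bool" and a
  assume *: "\<And>x. (\<And>y. y < x \<Longrightarrow> P y) \<Longrightarrow> P x"
  show "P a"
    by (rule measure_induct_rule[where f = "\<lambda>x. to_nat (Rep_enumerated x)"])
      (rule *, simp only: less_enumerated_def)
qed

end

lemma prod_Basis_cart:
  fixes x :: "real ^ 'n"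
  shows "(\<Prod>b\<in>Basis. x \<bullet> b) = (\<Prod>i\<in>UNIV. x $ i)"
proof -
  have B: "Basis = (\<lambda>i. axis i (1::real)) ` (UNIV :: 'n set)" by (auto simp: Basis_vec_def)
  have I: "inj (\<lambda>i::'n. axis i (1::real))" by (auto simp: inj_def axis_eq_axis)
  show ?thesis unfolding B prod.reindex[OF I] by (simp add: inner_axis)
qed

text \<open>Lebesgue measure is determined by its values on boxes. The preimage of a box is the box
  with permuted corner coordinates, which has the same product of side lengths.\<close>

lemma lborel_distr_rename_coordinates:
  fixes g :: "'m::finite \<Rightarrow> 'n::finite"
  assumes g: "bij g"
  shows "distr lborel borel (\<lambda>x :: real ^ 'n. \<chi> i. x $ g i) = (lborel :: (real ^ 'm) measure)"
proof (rule lborel_eqI[symmetric])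
  let ?\<phi> = "\<lambda>x :: real ^ 'n. (\<chi> i. x $ g i) :: real ^ 'm"
  let ?\<psi> = "\<lambda>x :: real ^ 'm. (\<chi> j. x $ inv g j) :: real ^ 'n"
  have [measurable]: "?\<phi> \<in> borel_measurable borel"
    by (intro borel_measurable_continuous_onI continuous_on_vec_lambda continuous_intros)
  fix l u :: "real ^ 'm"
  assume lu: "\<And>b. b \<in> Basis \<Longrightarrow> l \<bullet> b \<le> u \<bullet> b"
  have le: "l $ i \<le> u $ i" for i using lu[of "axis i 1"] by (simp add: inner_axis)
  have gi: "inv g (g i) = i" "g (inv g j) = j" for i j
    using g by (auto simp: bij_def surj_f_inv_f)
  have "?\<phi> -` box l u = box (?\<psi> l) (?\<psi> u)"
  proof (intro set_eqI)
    fix x show "x \<in> ?\<phi> -` box l u \<longleftrightarrow> x \<in> box (?\<psi> l) (?\<psi> u)"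
      using gi by (simp add: mem_box_cart) metis
  qed
  then have "emeasure (distr lborel borel ?\<phi>) (box l u) = emeasure lborel (box (?\<psi> l) (?\<psi> u))"
    by (subst emeasure_distr) auto
  also have "\<dots> = (\<Prod>b\<in>Basis. (?\<psi> u - ?\<psi> l) \<bullet> b)"
    by (rule emeasure_lborel_box) (use le in \<open>auto simp: Basis_vec_def inner_axis\<close>)
  also have "(\<Prod>b\<in>Basis. (?\<psi> u - ?\<psi> l) \<bullet> b) = (\<Prod>j\<in>UNIV. (u - l) $ inv g j)"
    by (simp add: prod_Basis_cart)
  also have "\<dots> = (\<Prod>i\<in>UNIV. (u - l) $ i)"
    by (rule prod.reindex_bij_betw[OF bij_imp_bij_inv[OF g]])
  finally show "emeasure (distr lborel borel ?\<phi>) (box l u) = (\<Prod>b\<in>Basis. (u - l) \<bullet> b)"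
    by (simp only: prod_Basis_cart)
qed simp

text \<open>The renaming \<open>\<phi>\<close> is a linear isometry preserving Lebesgue measure, so
  it carries parallel bodies to parallel bodies of equal volume.\<close>

lemma steiner_formula:
  fixes K :: "(real ^ 'n) set"
  assumes K: "compact K" "convex K"
  obtains p :: "real poly" where "degree p \<le> CARD('n)"
    "\<And>r. r \<ge> 0 \<Longrightarrow> measure lborel (K + cball 0 r) = poly p r"
proof -
  define \<phi> :: "real ^ 'n \<Rightarrow> real ^ 'n enumerated" where "\<phi> x = (\<chi> i. x $ Rep_enumerated i)" for x
  have lin: "linear \<phi>" by (rule linearI) (auto simp: \<phi>_def vec_eq_iff)
  have surj: "\<phi> (\<chi> j. y $ Abs_enumerated j) = y" for y
    by (simp add: \<phi>_def vec_eq_iff Rep_enumerated_inverse)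
  have norm: "norm (\<phi> x) = norm x" for x
    unfolding norm_vec_def L2_set_def \<phi>_def
    by (simp add: sum.reindex_bij_betw[OF bij_Rep_enumerated, of "\<lambda>i. (x $ i)\<^sup>2"])
  have inj: "inj \<phi>"
    unfolding linear_injective_0[OF lin]
  proof (intro allI impI)
    fix x assume "\<phi> x = 0"
    then show "x = 0" using norm[of x] by simp
  qed
  have cball: "\<phi> ` cball 0 r = cball 0 r" for r
  proof (intro equalityI subsetI)
    fix y :: "real ^ 'n enumerated" assume "y \<in> cball 0 r"
    then have "(\<chi> j. y $ Abs_enumerated j) \<in> cball 0 r"
      using norm[of "\<chi> j. y $ Abs_enumerated j"] surj[of y] by simp
    then show "y \<in> \<phi> ` cball 0 r" using surj[of y] by (intro image_eqI) simp_all
  qed (auto simp: norm)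
  have img: "\<phi> ` (K + cball 0 r) = \<phi> ` K + cball 0 r" for r
  proof -
    have "\<phi> ` (K + cball 0 r) = \<phi> ` K + \<phi> ` cball 0 r"
      by (force simp: set_plus_def linear_add[OF lin] image_iff)
    then show ?thesis by (simp add: cball)
  qed
  have [measurable]: "\<phi> \<in> borel_measurable borel"
    by (intro borel_measurable_continuous_onI linear_continuous_on_compose[OF continuous_on_id lin, simplified])
  have distr: "distr lborel borel \<phi> = lborel"
    using lborel_distr_rename_coordinates[OF bij_Rep_enumerated] by (simp add: \<phi>_def[abs_def])
  have comp: "compact (\<phi> ` K)"
    using compact_continuous_image[OF linear_continuous_on K(1)] lin linear_conv_bounded_linear by blast
  have eq: "measure lborel (K + cball 0 r) = measure lebesgue (\<phi> ` K + cball 0 r)" for r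
  proof -
    have b: "\<phi> ` K + cball 0 r \<in> sets borel"
      by (intro borel_closed compact_imp_closed compact_set_plus_cball comp)
    then have "measure lebesgue (\<phi> ` K + cball 0 r) = measure (distr lborel borel \<phi>) (\<phi> ` K + cball 0 r)"
      by (simp add: distr)
    also have "\<dots> = measure lborel (\<phi> -` (\<phi> ` (K + cball 0 r)))"
      using b by (subst measure_distr) (simp_all add: img)
    finally show ?thesis using inj_vimage_image_eq[OF inj] by simp
  qed
  have "convex (\<phi> ` K)" using convex_linear_image[OF lin K(2)] .
  then obtain p :: "real poly" where "degree p \<le> CARD('n enumerated)"
    "\<And>r. r \<ge> 0 \<Longrightarrow> measure lebesgue (\<phi> ` K + cball 0 r) = poly p r"
    using steiner_compact_convex[OF comp] by blast
  moreover have "CARD('n enumerated) = CARD('n)"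
    using bij_betw_same_card[OF bij_Rep_enumerated] .
  ultimately show thesis using that eq by simp
qed

section \<open>Intrinsic volumes\<close>

text \<open>This resolves the definite description: any polynomial giving the parallel volumes
  yields an admissible sequence, and it is the only one since polynomials agreeing on
  \<open>[0, \<infinity>)\<close> have equal coefficients and the ball volumes are nonzero.\<close>

lemma intrinsic_volume_eq_coeff:
  fixes K :: "'a::euclidean_space set" and p :: "real poly"
  assumes deg: "degree p \<le> DIM('a)"
    and p: "\<And>r. r \<ge> 0 \<Longrightarrow> measure lborel (K + cball 0 r) = poly p r"
    and k: "k \<le> DIM('a)"
  shows "intrinsic_volume k K = coeff p (DIM('a) - k) / unit_ball_vol (real (DIM('a) - k))"
proof -
  define n where "n = DIM('a)"
  define \<kappa> where "\<kappa> i = unit_ball_vol (real (i::nat))" for i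
  have \<kappa>: "\<kappa> i > 0" for i by (simp add: \<kappa>_def)
  define V where "V j = (if j \<le> n then coeff p (n - j) / \<kappa> (n - j) else 0)" for j
  have V: "poly p r = (\<Sum>j\<le>n. \<kappa> (n - j) * V j * r ^ (n - j))" for r
  proof -
    have "poly p r = (\<Sum>i\<le>n. coeff p i * r ^ i)"
      unfolding poly_altdef
      by (rule sum.mono_neutral_left) (use deg in \<open>auto simp: n_def coeff_eq_0\<close>)
    also have "\<dots> = (\<Sum>j\<le>n. coeff p (n - j) * r ^ (n - j))"
      by (rule sum.reindex_bij_witness[of _ "\<lambda>i. n - i" "\<lambda>i. n - i"]) auto
    also have "\<dots> = (\<Sum>j\<le>n. \<kappa> (n - j) * V j * r ^ (n - j))"
      by (rule sum.cong) (use \<kappa> in \<open>auto simp: V_def less_imp_neq[THEN not_sym]\<close>)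
    finally show ?thesis .
  qed
  have "(THE V. (\<forall>j>n. V j = 0) \<and>
      (\<forall>r\<ge>0. measure lborel (K + cball 0 r) = (\<Sum>j\<le>n. \<kappa> (n - j) * V j * r ^ (n - j)))) = V"
  proof (rule the_equality)
    show "(\<forall>j>n. V j = 0) \<and>
      (\<forall>r\<ge>0. measure lborel (K + cball 0 r) = (\<Sum>j\<le>n. \<kappa> (n - j) * V j * r ^ (n - j)))"
      using V p by (simp add: V_def)
  next
    fix W assume W: "(\<forall>j>n. W j = 0) \<and>
      (\<forall>r\<ge>0. measure lborel (K + cball 0 r) = (\<Sum>j\<le>n. \<kappa> (n - j) * W j * r ^ (n - j)))"
    \<comment> \<open>The competitor \<open>W\<close> is packed into a polynomial, which agrees with
      \<open>p\<close> at the \<open>n + 1\<close> nodes \<open>0, ..., n\<close>.\<close>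
    define q where "q = (\<Sum>j\<le>n. monom (\<kappa> (n - j) * W j) (n - j))"
    have "p = q"
    proof (rule poly_eqI_degree[of "real ` {..n}"])
      fix x assume "x \<in> real ` {..n}"
      then have "x \<ge> 0" by auto
      then show "poly p x = poly q x"
        using W p[of x] by (simp add: q_def poly_sum poly_monom)
    next
      have "degree q \<le> n" unfolding q_def
        by (rule degree_sum_le) (auto intro: order_trans[OF degree_monom_le])
      then show "degree q < card (real ` {..n})" by (simp add: card_image)
      show "degree p < card (real ` {..n})" using deg by (simp add: card_image n_def)
    qed
    have "W j = V j" for j
    proof (cases "j \<le> n")
      case True
      have "coeff q (n - j) = (\<Sum>i\<le>n. if i = j then \<kappa> (n - j) * W j else 0)"
        unfolding q_def coeff_sum by (rule sum.cong) (use True in auto)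
      also have "\<dots> = \<kappa> (n - j) * W j" using True by simp
      finally show ?thesis using True \<kappa>[of "n - j"] \<open>p = q\<close> by (simp add: V_def)
    qed (use W in \<open>simp add: V_def\<close>)
    then show "W = V" by blast
  qed
  then show ?thesis
    unfolding intrinsic_volume_def using k by (simp add: n_def \<kappa>_def V_def)
qed

lemma intrinsic_volume_empty:
  assumes "k \<le> DIM('a::euclidean_space)"
  shows "intrinsic_volume k ({} :: 'a set) = 0"
  using intrinsic_volume_eq_coeff[of 0 "{} :: 'a set" k] assms by (simp add: set_plus_def)

lemma cball_add_cball:
  fixes a b :: "'a::real_normed_vector"
  assumes "r \<ge> 0" "s \<ge> 0"
  shows "cball a r + cball b s = cball (a + b) (r + s)"
proof (intro equalityI subsetI)
  fix x assume "x \<in> cball a r + cball b s"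
  then obtain y z where "y \<in> cball a r" "z \<in> cball b s" "x = y + z" by (rule set_plus_elim)
  then show "x \<in> cball (a + b) (r + s)"
    using dist_triangle_add[of a b y z] by simp
next
  fix x assume x: "x \<in> cball (a + b) (r + s)"
  show "x \<in> cball a r + cball b s"
  proof (cases "r + s = 0")
    case True
    then have "r = 0" "s = 0" using assms by auto
    then show ?thesis using x by (auto simp: set_plus_def)
  next
    case False
    \<comment> \<open>The displacement of \<open>x\<close> from \<open>a + b\<close> is split
      between the two balls in the ratio of their radii.\<close>
    define d where "d = (1 / (r + s)) *\<^sub>R (x - (a + b))"
    have rs: "r + s > 0" using False assms by linarith
    have "norm d \<le> 1" using x rs by (simp add: d_def dist_norm norm_minus_commute divide_simps)
    then have "a + r *\<^sub>R d \<in> cball a r" "b + s *\<^sub>R d \<in> cball b s"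
      using assms by (auto simp: dist_norm mult_left_le)
    then have "(a + r *\<^sub>R d) + (b + s *\<^sub>R d) \<in> cball a r + cball b s" by (rule set_plus_intro)
    moreover have "(r + s) *\<^sub>R d = x - (a + b)" using rs by (simp add: d_def)
    then have "(a + r *\<^sub>R d) + (b + s *\<^sub>R d) = x" by (simp add: algebra_simps)
    ultimately show ?thesis by simp
  qed
qed

text \<open>The parallel volume is the unit ball volume times \<open>(R + r) ^ DIM('a)\<close>, so
  the coefficients come from the binomial theorem.\<close>

lemma intrinsic_volume_cball:
  fixes a :: "'a::euclidean_space"
  assumes k: "k \<le> DIM('a)" and R: "R \<ge> 0"
  shows "intrinsic_volume k (cball a R) =
    real (DIM('a) choose k) * unit_ball_vol (real DIM('a)) / unit_ball_vol (real (DIM('a) - k)) * R ^ k"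
proof -
  define p :: "real poly" where "p = smult (unit_ball_vol (real DIM('a))) ([:R, 1:] ^ DIM('a))"
  have "degree p \<le> DIM('a)"
    unfolding p_def using degree_power_le[of "[:R, 1:]" "DIM('a)"]
    by (intro order_trans[OF degree_smult_le]) simp
  moreover have "measure lborel (cball a R + cball 0 r) = poly p r" if "r \<ge> 0" for r
    using that R by (simp add: cball_add_cball content_cball p_def)
  ultimately have "intrinsic_volume k (cball a R) = coeff p (DIM('a) - k) / unit_ball_vol (real (DIM('a) - k))"
    using k by (rule intrinsic_volume_eq_coeff)
  also have "coeff p (DIM('a) - k) = unit_ball_vol (real DIM('a)) * (real (DIM('a) choose k) * R ^ k)"
    unfolding p_def coeff_smult
    using k by (simp add: coeff_linear_poly_power binomial_symmetric[symmetric])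
  finally show ?thesis by simp
qed

text \<open>For \<open>0 \<le> r \<le> n * R\<close> the parallel body lies in a ball of radius
  \<open>(1 + n) * R\<close>, so the Steiner polynomial is there at most a multiple of
  \<open>R ^ n\<close>. The coefficient of index \<open>n - k\<close> is therefore at most a
  multiple of \<open>R ^ n / R ^ (n - k) = R ^ k\<close>.\<close>

lemma intrinsic_volume_bound:
  assumes k: "k \<le> CARD('n::finite)"
  obtains C where "C \<ge> 0"
    "\<And>(K :: (real ^ 'n) set) R. compact K \<Longrightarrow> convex K \<Longrightarrow> R > 0 \<Longrightarrow> K \<subseteq> cball 0 R
      \<Longrightarrow> intrinsic_volume k K \<le> C * R ^ k"
proof -
  define n where "n = CARD('n)"
  define \<kappa> where "\<kappa> i = unit_ball_vol (real (i::nat))" for i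
  have \<kappa>: "\<kappa> i > 0" for i by (simp add: \<kappa>_def)
  obtain c where c: "c \<ge> 0"
    "\<And>(p :: real poly) R M. degree p \<le> n \<Longrightarrow> R > 0 \<Longrightarrow>
      (\<And>x. 0 \<le> x \<Longrightarrow> x \<le> real n * R \<Longrightarrow> \<bar>poly p x\<bar> \<le> M) \<Longrightarrow> \<bar>coeff p (n - k)\<bar> * R ^ (n - k) \<le> c * M"
    using poly_coeff_bound[of n "n - k"] by metis
  define C where "C = c * (\<kappa> n * (1 + real n) ^ n) / \<kappa> (n - k)"
  show thesis
  proof
    show "C \<ge> 0" using c(1) \<kappa> by (simp add: C_def less_imp_le)
    fix K :: "(real ^ 'n) set" and R :: real
    assume K: "compact K" "convex K" and R: "R > 0" and KR: "K \<subseteq> cball 0 R"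
    obtain p :: "real poly" where p: "degree p \<le> CARD('n)"
      "\<And>r. r \<ge> 0 \<Longrightarrow> measure lborel (K + cball 0 r) = poly p r"
      using steiner_formula[OF K] by blast
    have "\<bar>poly p r\<bar> \<le> \<kappa> n * (1 + real n) ^ n * R ^ n" if r: "0 \<le> r" "r \<le> real n * R" for r
    proof -
      have "K + cball 0 r \<subseteq> cball 0 R + cball 0 r" by (rule set_plus_mono2[OF KR order_refl])
      also have "\<dots> = cball 0 (R + r)" using R r by (simp add: cball_add_cball)
      also have "\<dots> \<subseteq> cball 0 ((1 + real n) * R)" using r by (simp add: subset_cball algebra_simps)
      finally have "measure lebesgue (K + cball 0 r) \<le> measure lebesgue (cball (0 :: real ^ 'n) ((1 + real n) * R))"
        by (intro measure_mono_fmeasurable fmeasurableD lmeasurable_compact compact_set_plus_cball K) auto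
      moreover have "K + cball 0 r \<in> sets lborel"
        using compact_imp_closed[OF compact_set_plus_cball[OF K(1)], of r] by simp
      ultimately have "poly p r \<le> \<kappa> n * ((1 + real n) * R) ^ n"
        using R p(2)[OF r(1)] by (simp add: content_cball \<kappa>_def n_def)
      moreover have "poly p r \<ge> 0" using p(2)[OF r(1)] by (metis measure_nonneg)
      ultimately show ?thesis by (simp add: power_mult_distrib mult.assoc)
    qed
    then have "\<bar>coeff p (n - k)\<bar> * R ^ (n - k) \<le> c * (\<kappa> n * (1 + real n) ^ n * R ^ n)"
      by (intro c(2) R) (use p(1) in \<open>simp_all add: n_def\<close>)
    also have "R ^ n = R ^ k * R ^ (n - k)"
      using k by (simp add: n_def flip: power_add)
    finally have "\<bar>coeff p (n - k)\<bar> * R ^ (n - k) \<le> (c * (\<kappa> n * (1 + real n) ^ n) * R ^ k) * R ^ (n - k)"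
      by (simp add: mult_ac)
    then have "\<bar>coeff p (n - k)\<bar> \<le> c * (\<kappa> n * (1 + real n) ^ n) * R ^ k"
      using R by simp
    moreover have "intrinsic_volume k K = coeff p (n - k) / \<kappa> (n - k)"
      using intrinsic_volume_eq_coeff[of p K k] p k by (simp add: n_def \<kappa>_def)
    ultimately show "intrinsic_volume k K \<le> C * R ^ k"
      using \<kappa>[of "n - k"] by (simp add: C_def divide_right_mono)
  qed
qed

section \<open>Sublevel sets of coercive convex functions\<close>

lemma convex_sublevel:
  assumes "convex_fun u"
  shows "convex {x. u x < ereal t}"
  unfolding convex_alt
proof (intro ballI allI impI)
  fix x y and s :: real
  assume x: "x \<in> {x. u x < ereal t}" and y: "y \<in> {x. u x < ereal t}" and s: "0 \<le> s \<and> s \<le> 1"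
  \<comment> \<open>\<open>convex_fun\<close> speaks only of weights strictly between
    \<open>0\<close> and \<open>1\<close>, so the endpoints are separate.\<close>
  consider "s = 0" | "s = 1" | "0 < s" "s < 1" using s by fastforce
  then show "(1 - s) *\<^sub>R x + s *\<^sub>R y \<in> {x. u x < ereal t}"
  proof cases
    case 3
    have "u ((1 - s) *\<^sub>R x + s *\<^sub>R y) \<le> ereal (1 - s) * u x + ereal s * u y"
      using assms 3 unfolding convex_fun_def by blast
    also have "\<dots> < ereal (1 - s) * ereal t + ereal s * ereal t"
      by (intro ereal_add_strict_mono2 ereal_mult_strict_left_mono) (use x y 3 in auto)
    also have "\<dots> = ereal t" by (simp add: algebra_simps)
    finally show ?thesis by simp
  qed (use x y in auto)
qed

text \<open>Lower semicontinuity gives a real lower bound near every point, and a finite subcover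
  reduces these to a minimum.\<close>

lemma lower_semicontinuous_bounded_below_on_compact:
  fixes u :: "'a::metric_space \<Rightarrow> ereal"
  assumes "compact K" and lsc: "lower_semicontinuous u" and "\<And>x. u x \<noteq> -\<infinity>"
  obtains m :: real where "\<And>x. x \<in> K \<Longrightarrow> ereal m \<le> u x"
proof -
  have "\<exists>m U. open U \<and> x \<in> U \<and> (\<forall>y\<in>U. ereal m \<le> u y)" for x
  proof -
    have "-\<infinity> < u x" using assms(3)[of x] by (cases "u x") auto
    then obtain m where m: "ereal m < u x" using ereal_dense2 by blast
    then have "eventually (\<lambda>y. ereal m < u y) (at x)"
      using lsc unfolding lower_semicontinuous_def le_Liminf_iff by blast
    then obtain U where "open U" "x \<in> U" "\<forall>y\<in>U. y \<noteq> x \<longrightarrow> ereal m < u y"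
      unfolding eventually_at_topological by auto
    \<comment> \<open>\<open>Liminf (at x)\<close> ignores the point \<open>x\<close> itself, where
      the bound holds by the choice of \<open>m\<close>.\<close>
    then show ?thesis using m by (intro exI[of _ m] exI[of _ U]) (metis less_imp_le)
  qed
  then obtain m U where U: "\<And>x. open (U x)" "\<And>x. x \<in> U x" "\<And>x y. y \<in> U x \<Longrightarrow> ereal (m x) \<le> u y"
    by metis
  obtain D where D: "D \<subseteq> K" "finite D" "K \<subseteq> (\<Union>x\<in>D. U x)"
    using compactE_image[OF assms(1), of K U] U(1,2) by blast
  \<comment> \<open>Inserting \<open>0\<close> keeps the minimum defined when \<open>D\<close> is
    empty.\<close>
  have "ereal (Min (insert 0 (m ` D))) \<le> u y" if y: "y \<in> K" for y
  proof -
    obtain x where "x \<in> D" "y \<in> U x" using subsetD[OF D(3) y] by auto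
    moreover have "Min (insert 0 (m ` D)) \<le> m x" using D(2) \<open>x \<in> D\<close> by simp
    ultimately show ?thesis using U(3) by (meson ereal_less_eq(3) order_trans)
  qed
  then show thesis using that by blast
qed

text \<open>Choose \<open>x0\<close> with \<open>u x0 = c\<close> finite. By coercivity
  \<open>u\<close> exceeds \<open>c + 1\<close> outside some ball around \<open>x0\<close>, and
  convexity along rays from \<open>x0\<close> turns this into linear growth. Below the ball minimum
  and \<open>c\<close> no values occur at all.\<close>

lemma coercive_sublevel_growth:
  fixes u :: "'a::euclidean_space \<Rightarrow> ereal"
  assumes u: "u \<in> coercive_convex_funs"
  obtains a b m :: real where "a \<ge> 0" "b \<ge> 0"
    "\<And>t. {x. u x < ereal t} \<subseteq> cball 0 (a + b * \<bar>t\<bar>)"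
    "\<And>t. t < m \<Longrightarrow> {x. u x < ereal t} = {}"
proof (cases "\<forall>x. u x = \<infinity>")
  case True
  then show thesis using that[of 0 0 0] by simp
next
  case False
  have u': "\<And>x. u x \<noteq> -\<infinity>" "convex_fun u" "lower_semicontinuous u" "(u \<longlongrightarrow> \<infinity>) at_infinity"
    using u by (auto simp: coercive_convex_funs_def)
  obtain x0 where "u x0 \<noteq> \<infinity>" using False by blast
  then obtain c where c: "u x0 = ereal c" using u'(1) by (cases "u x0") auto
  have "eventually (\<lambda>x. ereal (c + 1) < u x) at_infinity"
    using u'(4) by (simp add: tendsto_PInfty)
  then obtain B where B: "\<And>x. norm x \<ge> B \<Longrightarrow> ereal (c + 1) < u x"
    unfolding eventually_at_infinity by auto
  \<comment> \<open>With this radius \<open>norm (x - x0) \<ge> R\<close> implies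
    \<open>norm x \<ge> B\<close>; the summand \<open>1\<close> makes \<open>R\<close>
    positive.\<close>
  define R where "R = \<bar>B\<bar> + norm x0 + 1"
  have R: "R > 0" by (simp add: R_def add_nonneg_pos)
  have far: "ereal (c + 1) < u x" if "norm (x - x0) \<ge> R" for x
    using that norm_triangle_ineq4[of x x0] by (intro B) (simp add: R_def)
  have growth: "norm (x - x0) \<le> R * (1 + \<bar>c\<bar> + \<bar>t\<bar>)" if "u x < ereal t" for x t
  proof (cases "norm (x - x0) \<le> R")
    case True
    also have "R \<le> R * (1 + \<bar>c\<bar> + \<bar>t\<bar>)" using R by simp
    finally show ?thesis .
  next
    case False
    define s where "s = R / norm (x - x0)"
    have pos: "norm (x - x0) > 0" using False R by linarith
    then have s: "0 < s" "s < 1" using False R by (simp_all add: s_def)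
    \<comment> \<open>This is the point where the segment from \<open>x0\<close> to \<open>x\<close>
      meets the sphere of radius \<open>R\<close>. There \<open>u y > c + 1\<close>, and convexity
      bounds \<open>u y\<close> by \<open>(1 - s) * c + s * t\<close>.\<close>
    define y where "y = (1 - s) *\<^sub>R x0 + s *\<^sub>R x"
    have "y - x0 = s *\<^sub>R (x - x0)" by (simp add: y_def algebra_simps)
    then have "norm (y - x0) = R" using pos R by (simp add: s_def)
    then have "ereal (c + 1) < u y" by (intro far) simp
    also have "\<dots> \<le> ereal (1 - s) * u x0 + ereal s * u x"
      using u'(2) s unfolding convex_fun_def y_def by blast
    also have "\<dots> \<le> ereal (1 - s) * ereal c + ereal s * ereal t"
      unfolding c by (intro add_mono ereal_mult_left_mono) (use s that in auto)
    finally have "1 < s * (t - c)" by (simp add: algebra_simps)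
    then have "norm (x - x0) < R * (t - c)"
      using pos by (simp add: s_def field_simps)
    also have "\<dots> \<le> R * (1 + \<bar>c\<bar> + \<bar>t\<bar>)" using R by (intro mult_left_mono) auto
    finally show ?thesis by simp
  qed
  obtain m where m: "\<And>x. x \<in> cball x0 R \<Longrightarrow> ereal m \<le> u x"
    using lower_semicontinuous_bounded_below_on_compact[OF compact_cball u'(3,1)] by blast
  show thesis
  \<comment> \<open>The first two constants recentre the balls at the origin. The threshold combines
    the bound \<open>m\<close> inside the ball with \<open>u > c + 1\<close> outside it.\<close>
  proof (rule that[of "norm x0 + R * (1 + \<bar>c\<bar>)" R "min m c"])
    show "norm x0 + R * (1 + \<bar>c\<bar>) \<ge> 0" "R \<ge> 0" using R by simp_all
    show "{x. u x < ereal t} \<subseteq> cball 0 (norm x0 + R * (1 + \<bar>c\<bar>) + R * \<bar>t\<bar>)" for t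
    proof
      fix x assume "x \<in> {x. u x < ereal t}"
      then have "norm (x - x0) \<le> R * (1 + \<bar>c\<bar> + \<bar>t\<bar>)" using growth by simp
      then show "x \<in> cball 0 (norm x0 + R * (1 + \<bar>c\<bar>) + R * \<bar>t\<bar>)"
        using norm_triangle_sub[of x x0] by (simp add: algebra_simps)
    qed
    show "{x. u x < ereal t} = {}" if t: "t < min m c" for t
    proof -
      have "ereal t \<le> u x" for x
      proof (cases "norm (x - x0) \<ge> R")
        case True
        have "ereal t \<le> ereal (c + 1)" using t by simp
        also have "\<dots> < u x" using far[OF True] .
        finally show ?thesis by simp
      next
        case False
        then have "x \<in> cball x0 R" by (simp add: dist_norm norm_minus_commute)
        then show ?thesis using m[of x] t by (metis ereal_less_eq(3) less_imp_le min_less_iff_conj order_trans)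
      qed
      then show ?thesis by (auto simp: not_less)
    qed
  qed
qed

lemma norm_in_coercive_convex_funs:
  "(\<lambda>x :: 'a::euclidean_space. ereal (norm x)) \<in> coercive_convex_funs"
  unfolding coercive_convex_funs_def mem_Collect_eq
proof (intro conjI allI)
  show "convex_fun (\<lambda>x :: 'a. ereal (norm x))"
    unfolding convex_fun_def
  proof (intro allI impI)
    fix x y :: 'a and t :: real
    assume "0 < t \<and> t < 1"
    then show "ereal (norm ((1 - t) *\<^sub>R x + t *\<^sub>R y)) \<le> ereal (1 - t) * ereal (norm x) + ereal t * ereal (norm y)"
      using norm_triangle_ineq[of "(1 - t) *\<^sub>R x" "t *\<^sub>R y"] by simp
  qed
  show "lower_semicontinuous (\<lambda>x :: 'a. ereal (norm x))"
    unfolding lower_semicontinuous_def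
  proof
    fix x :: 'a
    have "((\<lambda>y. ereal (norm y)) \<longlongrightarrow> ereal (norm x)) (at x)" by (intro tendsto_intros)
    then have "Liminf (at x) (\<lambda>y. ereal (norm y)) = ereal (norm x)"
      by (rule lim_imp_Liminf[OF at_neq_bot])
    then show "ereal (norm x) \<le> Liminf (at x) (\<lambda>y. ereal (norm y))" by simp
  qed
  show "((\<lambda>x :: 'a. ereal (norm x)) \<longlongrightarrow> \<infinity>) at_infinity"
    unfolding tendsto_PInfty eventually_at_infinity
    by (metis ereal_less_eq(3) gt_ex less_ereal.simps(1) less_le_trans)
qed simp

section \<open>Finiteness of the integrals and the moment condition\<close>

lemma radon_measure_interval_finite:
  assumes "radon_measure \<nu>"
  shows "emeasure \<nu> {a..b :: real} < \<infinity>"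
  using assms unfolding radon_measure_def by blast

theorem proposition6p1:
  fixes \<nu> :: "real measure" and k :: nat
  assumes "k \<le> CARD('n::finite)"
    and "radon_measure \<nu>"
  shows "(\<forall>u \<in> (coercive_convex_funs :: (real ^ 'n \<Rightarrow> ereal) set).
            (\<integral>\<^sup>+t. ennreal (intrinsic_volume k (closure {x. u x < ereal t})) \<partial>\<nu>) < \<infinity>)
         \<longleftrightarrow> (\<integral>\<^sup>+t\<in>{0<..}. ennreal (t ^ k) \<partial>\<nu>) < \<infinity>"
proof
  have [measurable_cong]: "sets \<nu> = sets borel" using assms(2) by (simp add: radon_measure_def)
  {
    assume L: "\<forall>u \<in> (coercive_convex_funs :: (real ^ 'n \<Rightarrow> ereal) set).
            (\<integral>\<^sup>+t. ennreal (intrinsic_volume k (closure {x. u x < ereal t})) \<partial>\<nu>) < \<infinity>"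
    \<comment> \<open>\<open>c\<close> is the \<open>k\<close>-th intrinsic volume of the unit ball;
      the test function is the norm.\<close>
    define c where "c = real (CARD('n) choose k) * unit_ball_vol (real CARD('n)) / unit_ball_vol (real (CARD('n) - k))"
    have c: "c > 0" using assms(1) by (simp add: c_def)
    let ?f = "\<lambda>t. intrinsic_volume k (closure {x :: real ^ 'n. ereal (norm x) < ereal t})"
    have f: "?f t = c * t ^ k" if "t > 0" for t
    proof -
      have "{x :: real ^ 'n. ereal (norm x) < ereal t} = ball 0 t" by auto
      then show ?thesis
        using that assms(1) by (simp add: intrinsic_volume_cball c_def)
    qed
    have "ennreal c * (\<integral>\<^sup>+t\<in>{0<..}. ennreal (t ^ k) \<partial>\<nu>) = (\<integral>\<^sup>+t. ennreal c * (ennreal (t ^ k) * indicator {0<..} t) \<partial>\<nu>)"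
      by (rule nn_integral_cmult[symmetric]) measurable
    also have "\<dots> \<le> (\<integral>\<^sup>+t. ennreal (?f t) \<partial>\<nu>)"
    proof (rule nn_integral_mono)
      fix t
      show "ennreal c * (ennreal (t ^ k) * indicator {0<..} t) \<le> ennreal (?f t)"
      proof (cases "t > 0")
        case True
        then show ?thesis using c unfolding f[OF True] by (simp add: ennreal_mult)
      qed simp
    qed
    also have "\<dots> < \<infinity>" using bspec[OF L norm_in_coercive_convex_funs] by simp
    finally show "(\<integral>\<^sup>+t\<in>{0<..}. ennreal (t ^ k) \<partial>\<nu>) < \<infinity>"
      using c by (auto simp: ennreal_mult_less_top)
  }
  assume fin: "(\<integral>\<^sup>+t\<in>{0<..}. ennreal (t ^ k) \<partial>\<nu>) < \<infinity>"
  show "\<forall>u \<in> (coercive_convex_funs :: (real ^ 'n \<Rightarrow> ereal) set).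
            (\<integral>\<^sup>+t. ennreal (intrinsic_volume k (closure {x. u x < ereal t})) \<partial>\<nu>) < \<infinity>"
  proof
    fix u :: "real ^ 'n \<Rightarrow> ereal"
    assume u: "u \<in> coercive_convex_funs"
    obtain C where C: "C \<ge> 0" "\<And>(K :: (real ^ 'n) set) R. compact K \<Longrightarrow> convex K \<Longrightarrow> R > 0 \<Longrightarrow> K \<subseteq> cball 0 R
      \<Longrightarrow> intrinsic_volume k K \<le> C * R ^ k"
      using intrinsic_volume_bound[OF assms(1)] by metis
    obtain a b m :: real where ab: "a \<ge> 0" "b \<ge> 0"
      and sub: "\<And>t. {x. u x < ereal t} \<subseteq> cball 0 (a + b * \<bar>t\<bar>)"
      and empty: "\<And>t. t < m \<Longrightarrow> {x. u x < ereal t} = {}"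
      using coercive_sublevel_growth[OF u] by metis
    let ?f = "\<lambda>t. intrinsic_volume k (closure {x. u x < ereal t})"
    \<comment> \<open>The extra \<open>1\<close> in the radius keeps it positive even if
      \<open>a = b = 0\<close>.\<close>
    have bound: "?f t \<le> C * (1 + a + b * \<bar>t\<bar>) ^ k" for t
    proof (rule C(2))
      have "{x. u x < ereal t} \<subseteq> cball 0 (1 + a + b * \<bar>t\<bar>)"
        using sub[of t] by (rule order_trans) (simp add: subset_cball)
      then show sub': "closure {x. u x < ereal t} \<subseteq> cball 0 (1 + a + b * \<bar>t\<bar>)"
        by (rule closure_minimal) simp
      show "compact (closure {x. u x < ereal t})"
        using bounded_subset[OF bounded_cball sub[of t]] by (simp add: compact_closure)
      show "convex (closure {x. u x < ereal t})"
        using u by (intro convex_closure convex_sublevel) (simp add: coercive_convex_funs_def)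
      show "1 + a + b * \<bar>t\<bar> > 0" using ab by (simp add: add_pos_nonneg)
    qed
    \<comment> \<open>\<open>A\<close> dominates the integrand on \<open>[m, 1]\<close>, where
      \<open>\<bar>t\<bar> \<le> max \<bar>m\<bar> 1\<close>. \<open>D\<close> serves for
      \<open>t > 1\<close>, where \<open>1 + a + b * t \<le> (1 + a + b) * t\<close>. For
      \<open>t < m\<close> the integrand vanishes.\<close>
    define A where "A = C * (1 + a + b * max \<bar>m\<bar> 1) ^ k"
    define D where "D = C * (1 + a + b) ^ k"
    have AD: "A \<ge> 0" "D \<ge> 0" using ab C(1) by (simp_all add: A_def D_def)
    have le: "ennreal (?f t) \<le> ennreal A * indicator {m..1} t + ennreal D * (ennreal (t ^ k) * indicator {0<..} t)" for t
    proof -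
      consider "t < m" | "m \<le> t" "t \<le> 1" | "1 < t" by linarith
      then show ?thesis
      proof cases
        case 1
        then show ?thesis using assms(1) by (simp add: empty intrinsic_volume_empty)
      next
        case 2
        have "?f t \<le> A" unfolding A_def
          by (rule order_trans[OF bound]) (use ab C(1) 2 in \<open>intro mult_left_mono power_mono add_left_mono; auto\<close>)
        then show ?thesis using 2 by (simp add: ennreal_leI add_increasing2)
      next
        case 3
        have "1 + a + b * \<bar>t\<bar> \<le> (1 + a + b) * t"
          using 3 ab mult_left_mono[of 1 t "1 + a"] by (simp add: algebra_simps)
        then have "C * (1 + a + b * \<bar>t\<bar>) ^ k \<le> C * ((1 + a + b) * t) ^ k"
          using ab C(1) by (intro mult_left_mono power_mono) auto
        then have "?f t \<le> D * t ^ k"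
          using bound[of t] by (simp add: D_def power_mult_distrib mult.assoc)
        then show ?thesis using 3 AD
          by (auto simp: ennreal_mult[symmetric] intro!: ennreal_leI add_increasing)
      qed
    qed
    have "(\<integral>\<^sup>+t. ennreal (?f t) \<partial>\<nu>)
      \<le> (\<integral>\<^sup>+t. ennreal A * indicator {m..1} t + ennreal D * (ennreal (t ^ k) * indicator {0<..} t) \<partial>\<nu>)"
      by (intro nn_integral_mono le)
    also have "\<dots> = ennreal A * emeasure \<nu> {m..1} + ennreal D * (\<integral>\<^sup>+t\<in>{0<..}. ennreal (t ^ k) \<partial>\<nu>)"
      by (subst nn_integral_add; simp add: nn_integral_cmult nn_integral_cmult_indicator)
    \<comment> \<open>The compact interval has finite measure, and the other term is a multiple of
      the moment.\<close>
    also have "\<dots> < \<infinity>"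
      using radon_measure_interval_finite[OF assms(2)] fin by (simp add: ennreal_mult_less_top)
    finally show "(\<integral>\<^sup>+t. ennreal (?f t) \<partial>\<nu>) < \<infinity>" .
  qed
qed

end
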